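(* Let $k\ge 3$ be an integer and consider the following algorithm applied to $\min_x \frac12 x^\top \mathbf{L}x$, where $L$ is the gossip matrix of random $k$-regular graphs: set $\delta_0=\frac{k}{k+1}$, $x_1=x_0-\delta_0\mathbf{L}x_0$, and for $t=1,2,\dots$ $$\delta_t=\left(1-\frac{k-1}{k^2}\delta_{t-1}\right)^{-1},\qquad x_{t+1}=x_t+(\delta_t-1)(x_t-x_{t-1})-\delta_t\mathbf{L}x_t .$$ Then its expected error in the average-case framework (see context) satisfies, as $t\to\infty$, $$\mathbb{E}\|x_t-x_*\|^2=\Theta\left(\left(\frac{1}{k-1}\right)^t\cdot\left(\frac{1}{1+\frac{2}{k-2}\left(1-\frac{1}{(k-1)^t}\right)}\right)^2\right).$$
   Context: Setting. For a $k$-regular graph $G$ on $n$ vertices with adjacency matrix $A(G)$, the gossip matrix is $L=I_n-\frac1k A(G)$; $\mathbf{L}=L\otimes I_d$; the objective is $f(x)=\frac12x^\top\mathbf{L}x$ on $\mathbb{R}^{nd}$, so $\nabla f(x)=\mathbf{L}x$; $x_*$ is the consensus vector, each of whose $n$ blocks in $\mathbb{R}^d$ equals the average of the blocks of $x_0$. Residual polynomial. The algorithm $x_1=x_0-\delta_0\mathbf{L}x_0$, $x_{t+1}=x_t+(\delta_t-1)(x_t-x_{t-1})-\delta_t\mathbf{L}x_t$ for $t\ge1$, with predetermined coefficients $\delta_0=\frac{k}{k+1}$ and $\delta_t=\left(1-\frac{k-1}{k^2}\delta_{t-1}\right)^{-1}$ for $t\ge1$, determines real polynomials $P_t$ of degree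 $t$ with $P_t(0)=1$ such that $x_t-x_*=P_t(\mathbf{L})(x_0-x_* )$; here $P_t$ is obtained by replacing $\mathbf{L}$ by the scalar variable $\lambda$ and the iterates $x_t$ by $P_t(\lambda)$, starting with $P_0=1$ (using $\mathbf{L}x_*=0$). Average-case framework. It is assumed that $x_0-x_*$ is independent of the random matrix $L$ and $\mathbb{E}(x_0-x_* )(x_0-x_* )^\top=R^2I$ with $R>0$. The expected spectral distribution of the gossip matrix of random $k$-regular graphs is taken to be its large-$n$ limit, the measure $$d\mu(\lambda)=\frac{k}{2\pi}\,\frac{\sqrt{\frac{4(k-1)}{k^2}-(1-\lambda)^2}}{1-(1-\lambda)^2}\,d\lambda\quad\text{on}\quad\left[1-\frac{2\sqrt{k-1}}{k},\,1+\frac{2\sqrt{k-1}}{k}\right],$$ and the expected error at iteration $t$ is given by $\mathbb{E}\|x_t-x_*\|^2=R^2\int P_t(\lambda)^2\,d\mu(\lambda)$; this integral is the quantity estimated in the claim. $\Theta$ is with respect to $t\to\infty$ with $k$ and $R$ fixed: $a_t=\Theta(b_t)$ means there are constants $c,C>0$ (not depending on $t$) with $c\,b_t\le a_t\le C\,b_t$ for all sufficiently large $t$. *)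

theory Defs
  imports "HOL-Analysis.Analysis" "HOL-Library.Landau_Symbols"
    "HOL-Computational_Algebra.Polynomial"
begin

primrec delta :: "nat \<Rightarrow> nat \<Rightarrow> real" where
  "delta k 0 = real k / (real k + 1)"
| "delta k (Suc t) = inverse (1 - (real k - 1) / (real k)^2 * delta k t)"

(* The algorithm is parametrised by the scalar multiplication and by the operator L.  With
   scaleR and L the block gossip operator it produces the iterates x_t; with smult and L the
   multiplication by the variable it produces the residual polynomials. *)
fun gossip_iter ::
  "(real \<Rightarrow> 'a \<Rightarrow> 'a) \<Rightarrow> nat \<Rightarrow> ('a \<Rightarrow> 'a) \<Rightarrow> 'a \<Rightarrow> nat \<Rightarrow> 'a::ab_group_add" where
  "gossip_iter smul k L x0 0 = x0"
| "gossip_iter smul k L x0 (Suc 0) = x0 - smul (delta k 0) (L x0)"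
| "gossip_iter smul k L x0 (Suc (Suc t)) =
     gossip_iter smul k L x0 (Suc t)
     + smul (delta k (Suc t) - 1) (gossip_iter smul k L x0 (Suc t) - gossip_iter smul k L x0 t)
     - smul (delta k (Suc t)) (L (gossip_iter smul k L x0 (Suc t)))"

definition residual_poly :: "nat \<Rightarrow> nat \<Rightarrow> real poly" where
  "residual_poly k t = gossip_iter smult k (\<lambda>p. [:0, 1:] * p) 1 t"

definition gossip_spectral_measure :: "nat \<Rightarrow> real measure" where
  "gossip_spectral_measure k = density lborel (\<lambda>x. ennreal
     (indicator {1 - 2 * sqrt (real k - 1) / real k .. 1 + 2 * sqrt (real k - 1) / real k} x *
      (real k / (2 * pi) * (sqrt (4 * (real k - 1) / (real k)^2 - (1 - x)^2) / (1 - (1 - x)^2)))))"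

(* The expected squared distance to consensus in the average-case framework: the expected
   spectral distribution is replaced by its large-n limit, and R^2 is the variance scale in
   E (x_0 - x_* ) (x_0 - x_* )^T = R^2 I. *)
definition expected_error :: "nat \<Rightarrow> real \<Rightarrow> nat \<Rightarrow> real" where
  "expected_error k R t =
     R^2 * (\<integral>x. (poly (residual_poly k t) x)^2 \<partial>gossip_spectral_measure k)"

(* The remaining definitions do not enter the expected error; they serve to show that
   residual_poly is the residual polynomial of the algorithm on k-regular graphs.
   A vector of R^{nd} is represented by its n blocks in R^d. *)
definition gossip_matrix :: "nat \<Rightarrow> real^'n^'n \<Rightarrow> real^'n^'n" where
  "gossip_matrix k A = mat 1 - (1 / real k) *\<^sub>R A"

(* The action of the Kronecker product of M with the d-by-d identity. *)
definition block_apply :: "real^'n^'n \<Rightarrow> real^'d^'n \<Rightarrow> real^'d^'n" where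
  "block_apply M x = (\<chi> i. \<Sum>j\<in>UNIV. (M $ i $ j) *\<^sub>R (x $ j))"

definition consensus :: "real^'d^'n \<Rightarrow> real^'d^'n" where
  "consensus x = (\<chi> i. (1 / real CARD('n)) *\<^sub>R (\<Sum>j\<in>UNIV. x $ j))"

definition poly_apply :: "real poly \<Rightarrow> ('a \<Rightarrow> 'a) \<Rightarrow> 'a \<Rightarrow> 'a::real_vector" where
  "poly_apply p L v = (\<Sum>i\<le>degree p. coeff p i *\<^sub>R (L ^^ i) v)"

lemma poly_apply_bound:
  assumes "degree p \<le> n"
  shows "poly_apply p L v = (\<Sum>i\<le>n. coeff p i *\<^sub>R (L ^^ i) v)"
  unfolding poly_apply_def
  by (rule sum.mono_neutral_left) (use assms in \<open>auto simp: coeff_eq_0\<close>)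

lemma poly_apply_add: "poly_apply (p + q) L v = poly_apply p L v + poly_apply q L v"
  using poly_apply_bound[of "p + q" "max (degree p) (degree q)" L v]
    poly_apply_bound[of p "max (degree p) (degree q)" L v]
    poly_apply_bound[of q "max (degree p) (degree q)" L v]
  by (simp add: degree_add_le_max scaleR_add_left sum.distrib)

lemma poly_apply_smult: "poly_apply (smult c p) L v = c *\<^sub>R poly_apply p L v"
  using poly_apply_bound[of "smult c p" "degree p" L v]
  by (simp add: poly_apply_def scaleR_sum_right degree_smult_le)

lemma poly_apply_diff: "poly_apply (p - q) L v = poly_apply p L v - poly_apply q L v"
  using poly_apply_add[of p "smult (-1) q" L v] poly_apply_smult[of "-1" q L v] by simp

lemma poly_apply_var_mult:
  assumes "linear L"
  shows "poly_apply ([:0, 1:] * p) L v = L (poly_apply p L v)"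
proof -
  have "poly_apply ([:0, 1:] * p) L v =
      (\<Sum>i\<le>Suc (degree p). coeff (pCons 0 p) i *\<^sub>R (L ^^ i) v)"
    using poly_apply_bound[of "pCons 0 p" "Suc (degree p)" L v] by (simp add: degree_pCons_le)
  also have "\<dots> = (\<Sum>i\<le>degree p. coeff p i *\<^sub>R L ((L ^^ i) v))"
    by (subst sum.atMost_Suc_shift) simp
  also have "\<dots> = L (poly_apply p L v)"
    by (simp add: poly_apply_def linear_sum[OF assms] linear_scale[OF assms])
  finally show ?thesis .
qed

lemma gossip_iter_residual_poly:
  assumes "linear L" and "L xs = 0"
  shows "gossip_iter (*\<^sub>R) k L x0 t - xs = poly_apply (residual_poly k t) L (x0 - xs)"
proof -
  have L: "L x = L (x - xs)" for x using assms by (simp add: linear_diff)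
  show ?thesis
  proof (induction t rule: induct_nat_012)
    case 0
    show ?case by (simp add: residual_poly_def poly_apply_def)
  next
    case 1
    have P: "residual_poly k (Suc 0) = 1 - smult (delta k 0) ([:0, 1:] * 1)"
      by (simp add: residual_poly_def)
    have one: "poly_apply 1 L v = v" for v by (simp add: poly_apply_def)
    show ?case
      unfolding P poly_apply_diff poly_apply_smult poly_apply_var_mult[OF assms(1)] one
      using L[of x0] by simp
  next
    case (ge2 t)
    let ?x = "gossip_iter (*\<^sub>R) k L x0" and ?P = "residual_poly k"
    have P: "?P (Suc (Suc t)) = ?P (Suc t) + smult (delta k (Suc t) - 1) (?P (Suc t) - ?P t)
        - smult (delta k (Suc t)) ([:0, 1:] * ?P (Suc t))"
      by (simp add: residual_poly_def)
    have "?x (Suc (Suc t)) - xs = (?x (Suc t) - xs)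
        + (delta k (Suc t) - 1) *\<^sub>R ((?x (Suc t) - xs) - (?x t - xs))
        - delta k (Suc t) *\<^sub>R L (?x (Suc t) - xs)"
      using L[of "?x (Suc t)"] by simp
    then show ?case
      unfolding P poly_apply_diff poly_apply_add poly_apply_smult
        poly_apply_var_mult[OF assms(1)] using ge2 by simp
  qed
qed

lemma linear_block_apply: "linear (block_apply M)"
  by (rule linearI)
    (simp_all add: block_apply_def vec_eq_iff sum.distrib scaleR_sum_right algebra_simps sum_distrib_left)

lemma gossip_consensus:
  assumes "k > 0" and "\<And>i. (\<Sum>j\<in>UNIV. A $ i $ j) = real k"
  shows "block_apply (gossip_matrix k A) (consensus x) = 0"
proof -
  have "(\<Sum>j\<in>UNIV. gossip_matrix k A $ i $ j) = 0" for i
    using assms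
    by (simp add: gossip_matrix_def mat_def sum_subtractf flip: sum_divide_distrib)
  then show ?thesis
    by (simp add: block_apply_def consensus_def vec_eq_iff
        flip: sum_distrib_right sum_divide_distrib)
qed

lemma residual_poly_gossip:
  assumes "k > 0" and "\<And>i. (\<Sum>j\<in>UNIV. A $ i $ j) = real k"
  shows "gossip_iter (*\<^sub>R) k (block_apply (gossip_matrix k A)) x0 t - consensus x0 =
    poly_apply (residual_poly k t) (block_apply (gossip_matrix k A)) (x0 - consensus x0)"
  by (rule gossip_iter_residual_poly[OF linear_block_apply gossip_consensus[OF assms]])

end

theory Submission imports Defs begin

text \<open>The coefficients \<^term>\<open>delta k t\<close> are quotients of vertex counts of balls in the infinite
  \<open>k\<close>-regular tree. If \<open>S t\<close> is the number of vertices at distance at most \<open>t\<close> from a fixed one,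
  then \<open>delta k t = k * S t / S (t + 1)\<close> (\<open>delta_eq\<close>). Hence the polynomials \<open>S t * P t\<close>,
  where \<open>P t\<close> is the residual polynomial, satisfy a three-term recurrence with constant
  coefficients \<open>k * y\<close> and \<open>- (k - 1)\<close> in the variable \<open>y = 1 - \<lambda>\<close>
  (\<open>residual_poly_rec\<close>). This is a rescaled Chebyshev recurrence, and on the support of the spectral
  measure, where \<open>\<lambda> = 1 - c * cos x\<close> with \<open>c = 2 * sqrt (k - 1) / k\<close>, it has the explicit solution
  \<open>S t * P t * sin x = q ^ t * (sin ((t + 1) * x) + sin (t * x) / q)\<close> with \<open>q = sqrt (k - 1)\<close>
  (\<open>residual_poly_sin\<close>).

  Under the same substitution the spectral measure becomes a constant multiple of
  \<open>sin x ^ 2 / (1 - (c * cos x) ^ 2)\<close> on \<open>{0..pi}\<close> (\<open>has_integral_spectral\<close>). The factor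
  \<open>sin x ^ 2\<close> is just what the explicit formula requires, and the denominator lies between the positive
  constants \<open>1 - c ^ 2\<close> and \<open>1\<close>, because \<open>c < 1\<close> for \<open>k \<ge> 3\<close>. So the squared norm of \<open>P t\<close> agrees up
  to constants with \<open>q ^ (2 * t) / S t ^ 2\<close> times the integral of the square of a sum of two orthogonal
  sines, which does not depend on \<open>t\<close> (\<open>residual_poly_norm_bounds\<close>).

  Finally, \<open>(k - 1) ^ t / S t ^ 2\<close> is not merely comparable with the claimed rate but equal to it: the
  factor in the claim that is squared is \<open>(k - 1) ^ t / S t\<close>.\<close>

section \<open>The step sizes and balls in the regular tree\<close>

text \<open>The number of vertices in a ball of radius \<open>t\<close> of the \<open>k\<close>-regular tree, that is,
  \<open>1 + k + k * (k - 1) + \<dots> + k * (k - 1) ^ (t - 1)\<close>, in closed form.\<close>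

definition tree_ball :: "nat \<Rightarrow> nat \<Rightarrow> real" where
  "tree_ball k t = (real k * (real k - 1) ^ t - 2) / (real k - 2)"

lemma tree_ball_0 [simp]: "k \<ge> 3 \<Longrightarrow> tree_ball k 0 = 1"
  by (simp add: tree_ball_def)

lemma tree_ball_1: "k \<ge> 3 \<Longrightarrow> tree_ball k (Suc 0) = real k + 1"
  by (simp add: tree_ball_def field_simps)

lemma tree_ball_pos:
  assumes "k \<ge> 3"
  shows "tree_ball k t > 0"
proof -
  have "1 \<le> (real k - 1) ^ t" using assms by (intro one_le_power) simp
  then have "real k * 1 \<le> real k * (real k - 1) ^ t" by (intro mult_left_mono) auto
  then have "real k * (real k - 1) ^ t - 2 > 0" using assms by linarith
  with assms show ?thesis unfolding tree_ball_def by (intro divide_pos_pos) auto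
qed

lemma tree_ball_rec:
  "tree_ball k (Suc (Suc t)) = real k * tree_ball k (Suc t) - (real k - 1) * tree_ball k t"
  by (simp add: tree_ball_def diff_divide_distrib[symmetric] algebra_simps)

text \<open>With the claimed form of \<^term>\<open>delta k t\<close>, the recursion that defines the coefficients is the
  linear recursion \<open>tree_ball_rec\<close> divided by \<^term>\<open>real k * tree_ball k (Suc t)\<close>.\<close>

lemma delta_eq:
  assumes "k \<ge> 3"
  shows "delta k t = real k * tree_ball k t / tree_ball k (Suc t)"
proof (induction t)
  case 0
  show ?case using assms by (simp add: tree_ball_1)
next
  case (Suc t)
  let ?S = "tree_ball k"
  note pos = tree_ball_pos[OF assms]
  have "1 - (real k - 1) / (real k)\<^sup>2 * delta k t
      = (real k * ?S (Suc t) - (real k - 1) * ?S t) / (real k * ?S (Suc t))"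
    using assms pos[of "Suc t"] unfolding Suc by (simp add: field_simps power2_eq_square)
  also have "\<dots> = ?S (Suc (Suc t)) / (real k * ?S (Suc t))"
    by (simp add: tree_ball_rec)
  finally show ?case by simp
qed

section \<open>An explicit formula for the residual polynomials\<close>

text \<open>Writing \<open>\<lambda> = 1 - y\<close> merges the terms with \<open>P (t + 1)\<close>, so that an iteration reads
  \<open>P (t + 2) = \<delta> * y * P (t + 1) - (\<delta> - 1) * P t\<close>. Multiplying by the ball size clears the
  denominators: \<open>S (t + 2) * \<delta> = k * S (t + 1)\<close>, and therefore, by the recursion of the ball sizes,
  \<open>S (t + 2) * (\<delta> - 1) = (k - 1) * S t\<close>.\<close>

lemma residual_poly_rec:
  assumes "k \<ge> 3"
  shows "tree_ball k (Suc (Suc t)) * poly (residual_poly k (Suc (Suc t))) (1 - y)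
    = real k * y * (tree_ball k (Suc t) * poly (residual_poly k (Suc t)) (1 - y))
      - (real k - 1) * (tree_ball k t * poly (residual_poly k t) (1 - y))"
proof -
  let ?S = "tree_ball k" and ?P = "\<lambda>t. poly (residual_poly k t) (1 - y)"
  define d where "d = delta k (Suc t)"
  have d: "?S (Suc (Suc t)) * d = real k * ?S (Suc t)"
    using tree_ball_pos[OF assms, of "Suc (Suc t)"] by (simp add: d_def delta_eq[OF assms] del: delta.simps)
  have "?P (Suc (Suc t)) = ?P (Suc t) + (d - 1) * (?P (Suc t) - ?P t) - d * ((1 - y) * ?P (Suc t))"
    by (simp add: residual_poly_def d_def del: delta.simps)
  also have "\<dots> = y * d * ?P (Suc t) - (d - 1) * ?P t"
    by (simp add: algebra_simps)
  finally have "?S (Suc (Suc t)) * ?P (Suc (Suc t))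
      = ?S (Suc (Suc t)) * (y * d * ?P (Suc t) - (d - 1) * ?P t)"
    by simp
  also have "\<dots> = y * (?S (Suc (Suc t)) * d) * ?P (Suc t) - (?S (Suc (Suc t)) * d - ?S (Suc (Suc t))) * ?P t"
    by (simp add: algebra_simps)
  finally have "?S (Suc (Suc t)) * ?P (Suc (Suc t))
      = y * (?S (Suc (Suc t)) * d) * ?P (Suc t) - (?S (Suc (Suc t)) * d - ?S (Suc (Suc t))) * ?P t" .
  then show ?thesis
    unfolding d by (simp add: tree_ball_rec algebra_simps)
qed

definition support_radius :: "nat \<Rightarrow> real" where
  "support_radius k = 2 * sqrt (real k - 1) / real k"

text \<open>Both sides satisfy \<open>W (t + 2) = 2 * q * cos x * W (t + 1) - q ^ 2 * W t\<close> with
  \<open>q = sqrt (k - 1)\<close>: the left one by \<open>residual_poly_rec\<close>, the right one by the addition theorem for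
  the sine. On the right, the second sine reflects the initial value \<open>1 + 2 * q * cos x\<close> at
  \<open>t = 1\<close>, which differs by \<open>1\<close> from that of the rescaled Chebyshev polynomials of the second kind.\<close>

lemma residual_poly_sin:
  assumes "k \<ge> 3"
  shows "tree_ball k t * poly (residual_poly k t) (1 - support_radius k * cos x) * sin x =
    sqrt (real k - 1) ^ t * (sin (real (t + 1) * x) + sin (real t * x) / sqrt (real k - 1))"
proof -
  define q where "q = sqrt (real k - 1)"
  have q: "q > 0" "q\<^sup>2 = real k - 1" using assms by (auto simp: q_def)
  let ?W = "\<lambda>t. tree_ball k t * poly (residual_poly k t) (1 - support_radius k * cos x)"
  have kc: "real k * (support_radius k * cos x) = 2 * q * cos x"
    using assms by (simp add: support_radius_def q_def)
  have addsub: "sin (real (Suc (Suc n)) * x) = 2 * cos x * sin (real (Suc n) * x) - sin (real n * x)" for n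
  proof -
    have "real (Suc (Suc n)) * x = real (Suc n) * x + x" "real n * x = real (Suc n) * x - x"
      by (simp_all add: algebra_simps)
    then show ?thesis by (simp only: sin_add sin_diff) simp
  qed
  \<comment> \<open>The factor \<open>q\<close> avoids the exponent \<open>t - 1\<close>, which truncates at \<open>t = 0\<close>.\<close>
  have "q * (?W t * sin x) = q ^ t * (q * sin (real (t + 1) * x) + sin (real t * x))"
  proof (induction t rule: induct_nat_012)
    case 0
    show ?case using assms by (simp add: residual_poly_def)
  next
    case 1
    have "?W 1 = real k + 1 - real k * (1 - support_radius k * cos x)"
      using assms by (simp add: residual_poly_def tree_ball_1 field_simps)
    also have "\<dots> = 1 + 2 * q * cos x" using kc by (simp add: algebra_simps)
    finally have "?W 1 = 1 + 2 * q * cos x" .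
    then show ?case using addsub[of 0] by (simp add: algebra_simps)
  next
    case (ge2 t)
    have "q * (?W (Suc (Suc t)) * sin x)
        = 2 * q * cos x * (q * (?W (Suc t) * sin x)) - q\<^sup>2 * (q * (?W t * sin x))"
      unfolding residual_poly_rec[OF assms] kc q(2) by (simp add: algebra_simps)
    also have "\<dots> = q ^ Suc (Suc t) * (q * (2 * cos x * sin (real (Suc (Suc t)) * x) - sin (real (Suc t) * x))
        + (2 * cos x * sin (real (Suc t) * x) - sin (real t * x)))"
      unfolding ge2 by (simp add: algebra_simps power2_eq_square)
    finally show ?case using addsub[of t] addsub[of "Suc t"] by simp
  qed
  then have "?W t * sin x = q ^ t * (q * sin (real (t + 1) * x) + sin (real t * x)) / q"
    using q by (simp add: field_simps)
  also have "\<dots> = q ^ t * (sin (real (t + 1) * x) + sin (real t * x) / q)"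
    using q by (simp add: field_simps)
  finally show ?thesis unfolding q_def .
qed

section \<open>Integration against the spectral measure\<close>

text \<open>The two sines are orthogonal on \<open>{0..pi}\<close> and each has squared norm \<open>pi / 2\<close>; for \<open>t = 0\<close> the
  second one vanishes.\<close>

lemma has_integral_sin_pair:
  fixes b :: real
  assumes "t > 0"
  shows "((\<lambda>x. (sin (real (t + 1) * x) + b * sin (real t * x))\<^sup>2) has_integral pi / 2 * (1 + b\<^sup>2)) {0..pi}"
proof -
  let ?m = "real t"
  define F where "F = (\<lambda>x. (x - sin (2 * (?m + 1) * x) / (2 * (?m + 1))) / 2
    + b\<^sup>2 * ((x - sin (2 * ?m * x) / (2 * ?m)) / 2) + b * (sin x - sin ((2 * ?m + 1) * x) / (2 * ?m + 1)))"
  have n: "?m > 0" using assms by simp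
  have "((\<lambda>x. (sin (real (t + 1) * x) + b * sin (?m * x))\<^sup>2) has_integral F pi - F 0) {0..pi}"
  proof (rule fundamental_theorem_of_calculus)
    fix x :: real
    have e1: "(sin (real (t + 1) * x))\<^sup>2 = (1 - cos (2 * (?m + 1) * x)) / 2"
      using cos_double_sin[of "(?m + 1) * x"] by (simp add: algebra_simps)
    have e2: "(sin (?m * x))\<^sup>2 = (1 - cos (2 * ?m * x)) / 2"
      using cos_double_sin[of "?m * x"] by (simp add: algebra_simps)
    have "2 * sin (real (t + 1) * x) * sin (?m * x)
        = cos ((?m + 1) * x - ?m * x) - cos ((?m + 1) * x + ?m * x)"
      by (simp add: cos_add cos_diff add.commute)
    then have e3: "2 * sin (real (t + 1) * x) * sin (?m * x) = cos x - cos ((2 * ?m + 1) * x)"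
      by (simp add: algebra_simps)
    have sin': "((\<lambda>x. sin (a * x) / a) has_real_derivative cos (a * x)) (at x within {0..pi})"
      if "a > 0" for a
      using that by (auto intro!: derivative_eq_intros)
    have "(F has_real_derivative ((1 - cos (2 * (?m + 1) * x)) / 2
        + b\<^sup>2 * ((1 - cos (2 * ?m * x)) / 2) + b * (cos x - cos ((2 * ?m + 1) * x)))) (at x within {0..pi})"
      unfolding F_def using n
      by (intro DERIV_add DERIV_diff DERIV_cdivide DERIV_cmult DERIV_ident sin' DERIV_sin[THEN DERIV_subset]) auto
    also have "(1 - cos (2 * (?m + 1) * x)) / 2
        + b\<^sup>2 * ((1 - cos (2 * ?m * x)) / 2) + b * (cos x - cos ((2 * ?m + 1) * x))
        = (sin (real (t + 1) * x) + b * sin (?m * x))\<^sup>2"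
      unfolding e1[symmetric] e2[symmetric] e3[symmetric] by (simp add: power2_sum power_mult_distrib)
    finally show "(F has_vector_derivative (sin (real (t + 1) * x) + b * sin (?m * x))\<^sup>2) (at x within {0..pi})"
      by (simp add: has_real_derivative_iff_has_vector_derivative)
  qed simp
  moreover have "F pi - F 0 = pi / 2 * (1 + b\<^sup>2)"
  proof -
    have s: "sin (real m * pi) = 0" for m by (simp add: sin_npi)
    have "sin (2 * (?m + 1) * pi) = 0" "sin (2 * ?m * pi) = 0" "sin ((2 * ?m + 1) * pi) = 0"
      using s[of "2 * (t + 1)"] s[of "2 * t"] s[of "2 * t + 1"] by (simp_all add: algebra_simps)
    then show ?thesis by (simp add: F_def algebra_simps)
  qed
  ultimately show ?thesis by simp
qed

text \<open>The support stays away from \<open>0\<close> and \<open>2\<close>, the poles of the density, since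
  \<open>k ^ 2 - 4 * (k - 1) = (k - 2) ^ 2\<close> is positive.\<close>

lemma support_radius:
  assumes "k \<ge> 3"
  shows "support_radius k > 0" "(support_radius k)\<^sup>2 < 1" "(support_radius k)\<^sup>2 = 4 * (real k - 1) / (real k)\<^sup>2"
proof -
  show "support_radius k > 0" using assms by (simp add: support_radius_def)
  show e: "(support_radius k)\<^sup>2 = 4 * (real k - 1) / (real k)\<^sup>2"
    using assms by (simp add: support_radius_def power_divide power_mult_distrib)
  have "(real k)\<^sup>2 - 4 * (real k - 1) = (real k - 2)\<^sup>2" by (simp add: power2_eq_square algebra_simps)
  moreover have "(real k - 2)\<^sup>2 > 0" using assms by simp
  ultimately have "4 * (real k - 1) < (real k)\<^sup>2" by linarith
  then show "(support_radius k)\<^sup>2 < 1" unfolding e using assms by simp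
qed

text \<open>This is the substitution \<open>\<lambda> = 1 - c * cos x\<close>, with \<open>c\<close> the radius of the support around \<open>1\<close>. The
  square root in the density becomes \<open>c * sin x\<close>, and the derivative of the substitution supplies a
  second factor \<open>c * sin x\<close>.\<close>

lemma has_integral_spectral:
  fixes f :: "real \<Rightarrow> real"
  assumes k: "k \<ge> 3" and f: "continuous_on UNIV f"
  defines "h \<equiv> \<lambda>x. real k * (support_radius k)\<^sup>2 / (2 * pi) *
    (f (1 - support_radius k * cos x) * (sin x)\<^sup>2 / (1 - (support_radius k * cos x)\<^sup>2))"
  shows "(h has_integral integral\<^sup>L (gossip_spectral_measure k) f) {0..pi}"
proof -
  let ?c = "support_radius k"
  let ?d = "\<lambda>x. real k / (2 * pi) * (sqrt (?c\<^sup>2 - (1 - x)\<^sup>2) / (1 - (1 - x)\<^sup>2))"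
  let ?g = "\<lambda>x. 1 - ?c * cos x"
  note c = support_radius[OF k]
  have denom: "1 - (1 - x)\<^sup>2 > 0" if "x \<in> {1 - ?c..1 + ?c}" for x
  proof -
    have "\<bar>1 - x\<bar> \<le> \<bar>?c\<bar>" using that c by auto
    then have "(1 - x)\<^sup>2 \<le> ?c\<^sup>2" by (simp only: abs_le_square_iff)
    with c show ?thesis by simp
  qed
  have mu: "gossip_spectral_measure k
      = density lborel (\<lambda>x. ennreal (indicator {1 - ?c..1 + ?c} x * ?d x))"
    unfolding gossip_spectral_measure_def c(3) by (simp only: support_radius_def)
  have nonneg: "0 \<le> indicator {1 - ?c..1 + ?c} x * ?d x" for x
  proof (cases "x \<in> {1 - ?c..1 + ?c}")
    case True
    then have "\<bar>1 - x\<bar> \<le> \<bar>?c\<bar>" using c by auto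
    then have "(1 - x)\<^sup>2 \<le> ?c\<^sup>2" by (simp only: abs_le_square_iff)
    with denom[OF True] show ?thesis by simp
  qed simp
  have fb: "f \<in> borel_measurable borel" using f by (rule borel_measurable_continuous_onI)
  have "integral\<^sup>L (gossip_spectral_measure k) f
      = (LBINT x. (indicator {1 - ?c..1 + ?c} x * ?d x) *\<^sub>R f x)"
    unfolding mu using fb nonneg by (intro integral_density) auto
  also have "\<dots> = (LBINT x. (f x * ?d x) * indicator {?g 0..?g pi} x)"
    by (simp add: mult_ac)
  also have "\<dots> = (LBINT x. (f (?g x) * ?d (?g x)) * (?c * sin x) * indicator {0..pi} x)"
  proof (rule integral_substitution)
    have "continuous_on {?g 0..?g pi} (\<lambda>x. f x * ?d x)"
      using denom by (intro continuous_intros continuous_on_subset[OF f]) force+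
    then show "set_integrable lborel {?g 0..?g pi} (\<lambda>x. f x * ?d x)"
      by (rule borel_integrable_atLeastAtMost')
  qed (use c(1) in \<open>auto intro!: derivative_eq_intros continuous_intros sin_ge_zero mult_nonneg_nonneg\<close>)
  also have "\<dots> = (LBINT x:{0..pi}. h x)"
    unfolding set_lebesgue_integral_def
  proof (rule Bochner_Integration.integral_cong)
    fix x :: real
    have "sqrt (?c\<^sup>2 - (?c * cos x)\<^sup>2) = ?c * sin x" if "x \<in> {0..pi}"
    proof -
      have "?c\<^sup>2 - (?c * cos x)\<^sup>2 = (?c * sin x)\<^sup>2"
        by (simp add: power_mult_distrib sin_squared_eq algebra_simps)
      then show ?thesis using that c sin_ge_zero[of x] by simp
    qed
    then show "(f (?g x) * ?d (?g x)) * (?c * sin x) * indicator {0..pi} x = indicator {0..pi} x *\<^sub>R h x"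
      by (cases "x \<in> {0..pi}") (auto simp: h_def power2_eq_square)
  qed simp
  finally have eq: "integral\<^sup>L (gossip_spectral_measure k) f = (LBINT x:{0..pi}. h x)" .
  have "1 - (?c * cos x)\<^sup>2 \<noteq> 0" for x
  proof -
    have "(?c * cos x)\<^sup>2 \<le> ?c\<^sup>2 * 1"
      unfolding power_mult_distrib by (intro mult_left_mono) (auto simp: abs_square_le_1)
    with c show ?thesis by linarith
  qed
  then have "continuous_on {0..pi} h"
    unfolding h_def by (intro continuous_intros continuous_on_compose2[OF f]) auto
  then have "set_integrable lborel {0..pi} h" by (rule borel_integrable_atLeastAtMost')
  from set_borel_integral_eq_integral[OF this] show ?thesis
    unfolding eq by (simp add: has_integral_integrable_integral)
qed

text \<open>By the sine formula, the integrand given by \<open>has_integral_spectral\<close> is a multiple of the square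
  of the sine pair, divided by \<open>1 - (c * cos x) ^ 2\<close>, which lies between \<open>1 - c ^ 2\<close> and \<open>1\<close>. The
  normalising constant of the spectral measure cancels the integral of the sine pair exactly.\<close>

lemma residual_poly_norm_bounds:
  assumes k: "k \<ge> 3" and t: "t > 0"
  defines "b \<equiv> (real k - 1) ^ t / (tree_ball k t)\<^sup>2"
    and "I \<equiv> \<integral>x. (poly (residual_poly k t) x)\<^sup>2 \<partial>gossip_spectral_measure k"
  shows "b \<le> I" and "I \<le> b / (1 - (support_radius k)\<^sup>2)"
proof -
  let ?c = "support_radius k" and ?P = "poly (residual_poly k t)" and ?q = "sqrt (real k - 1)"
  let ?w = "\<lambda>x. (sin (real (t + 1) * x) + 1 / ?q * sin (real t * x))\<^sup>2"
  define K where "K = real k * ?c\<^sup>2 / (2 * pi)"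
  define h where "h x = K * ((?P (1 - ?c * cos x))\<^sup>2 * (sin x)\<^sup>2 / (1 - (?c * cos x)\<^sup>2))" for x
  note c = support_radius[OF k]
  have "K \<ge> 0" by (simp add: K_def)
  have "b > 0" using k tree_ball_pos[OF k, of t] by (simp add: b_def)
  have I: "(h has_integral I) {0..pi}"
    unfolding h_def K_def I_def by (intro has_integral_spectral k continuous_intros)
  have "((\<lambda>x. K * b * ?w x) has_integral K * b * (pi / 2 * (1 + (1 / ?q)\<^sup>2))) {0..pi}"
    by (intro has_integral_mult_right has_integral_sin_pair t)
  also have "K * b * (pi / 2 * (1 + (1 / ?q)\<^sup>2)) = b"
    unfolding K_def c(3) using k by (simp add: power_divide) (simp add: field_simps power2_eq_square)
  finally have w: "((\<lambda>x. K * b * ?w x) has_integral b) {0..pi}" .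
  have h: "h x = K * b * ?w x / (1 - (?c * cos x)\<^sup>2)" for x
  proof -
    have "(tree_ball k t * ?P (1 - ?c * cos x) * sin x)\<^sup>2 = (real k - 1) ^ t * ?w x"
      unfolding residual_poly_sin[OF k] using k
      by (simp add: power_mult_distrib power_even_abs flip: power_mult)
         (simp add: power_mult mult.commute[of t])
    then have "(?P (1 - ?c * cos x))\<^sup>2 * (sin x)\<^sup>2 = b * ?w x"
      using tree_ball_pos[OF k, of t] by (simp add: b_def power_mult_distrib field_simps)
    then show ?thesis by (simp add: h_def)
  qed
  have cos: "(?c * cos x)\<^sup>2 \<le> ?c\<^sup>2" for x
    unfolding power_mult_distrib by (rule mult_left_le) (auto simp: abs_square_le_1)
  have nn: "K * b * ?w x \<ge> 0" for x using \<open>K \<ge> 0\<close> \<open>b > 0\<close> by simp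
  show "b \<le> I"
  proof (rule has_integral_le[OF w I])
    fix x
    have "0 < 1 - (?c * cos x)\<^sup>2" "1 - (?c * cos x)\<^sup>2 \<le> 1" using cos[of x] c(2) by simp_all
    with nn[of x] show "K * b * ?w x \<le> h x"
      unfolding h by (simp only: pos_le_divide_eq mult_left_le)
  qed
  show "I \<le> b / (1 - ?c\<^sup>2)"
  proof (rule has_integral_le[OF I has_integral_divide[OF w]])
    fix x
    show "h x \<le> K * b * ?w x / (1 - ?c\<^sup>2)"
      unfolding h using nn[of x] cos[of x] c(2) by (intro divide_left_mono mult_pos_pos) auto
  qed
qed

section \<open>The rate of the expected error\<close>

lemma rate_eq:
  assumes "k \<ge> 3"
  shows "(1 / (real k - 1)) ^ t * (1 / (1 + 2 / (real k - 2) * (1 - 1 / (real k - 1) ^ t)))\<^sup>2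
    = (real k - 1) ^ t / (tree_ball k t)\<^sup>2"
proof -
  define p where "p = (real k - 1) ^ t"
  have p: "p > 0" and S: "tree_ball k t > 0" using assms tree_ball_pos by (auto simp: p_def)
  have "1 + 2 / (real k - 2) * (1 - 1 / p) = tree_ball k t / p"
    using p assms by (simp add: tree_ball_def p_def[symmetric] field_simps)
  then show ?thesis
    using p S by (simp add: power_one_over p_def[symmetric] power2_eq_square)
qed

theorem theorem5p2:
  fixes k :: nat and R :: real
  assumes "k \<ge> 3" and "R > 0"
  shows "(\<lambda>t. expected_error k R t) \<in> \<Theta>(\<lambda>t.
    (1 / (real k - 1)) ^ t *
    (1 / (1 + 2 / (real k - 2) * (1 - 1 / (real k - 1) ^ t)))\<^sup>2)"
proof -
  let ?b = "\<lambda>t. (real k - 1) ^ t / (tree_ball k t)\<^sup>2"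
  define C where "C = 1 - (support_radius k)\<^sup>2"
  have "C > 0" using support_radius[OF assms(1)] by (simp add: C_def)
  have "expected_error k R \<in> \<Theta>(?b)"
  proof (rule bigthetaI')
    show "R\<^sup>2 > 0" "R\<^sup>2 / C > 0" using assms \<open>C > 0\<close> by simp_all
    show "\<forall>\<^sub>F t in sequentially. R\<^sup>2 * norm (?b t) \<le> norm (expected_error k R t)
        \<and> norm (expected_error k R t) \<le> R\<^sup>2 / C * norm (?b t)"
      using eventually_gt_at_top[of "0 :: nat"]
    proof eventually_elim
      case (elim t)
      let ?I = "\<integral>x. (poly (residual_poly k t) x)\<^sup>2 \<partial>gossip_spectral_measure k"
      have b: "?b t \<ge> 0" using assms by simp
      note le = residual_poly_norm_bounds[OF assms(1) elim]
      have "R\<^sup>2 * ?b t \<le> R\<^sup>2 * ?I" "R\<^sup>2 * ?I \<le> R\<^sup>2 * (?b t / C)"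
        using le unfolding C_def by (intro mult_left_mono; simp)+
      moreover have "norm (?b t) = ?b t" "norm (expected_error k R t) = R\<^sup>2 * ?I"
        using b order_trans[OF b le(1)] by (simp_all only: expected_error_def real_norm_def abs_of_nonneg
            mult_nonneg_nonneg zero_le_power2)
      moreover have "R\<^sup>2 * (?b t / C) = R\<^sup>2 / C * ?b t" by simp
      ultimately show ?case by (simp only: simp_thms)
    qed
  qed
  then show ?thesis unfolding rate_eq[OF assms(1)] .
qed

end
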